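(* Let $N=\{1,\dots,n\}$ be a set of agents with $n\ge 2$, let $X$ be a finite set with $|X|\ge 3$, and let $\mathcal{P}$ be the set of all strict preferences over $X$. Let $f:\mathcal{P}^n\to X$ be a (unanimous) tops-only rule and let $P\in\mathcal{P}^n$. Then profile $P$ is either dictatorial for $f$ or manipulable for $f$.
   Context: A strict preference $P_i$ over $X$ is a strict linear order on $X$ ($xP_iy$ means $x$ is strictly preferred to $y$); its top $t(P_i)$ is its best alternative. A profile is $P=(P_1,\dots,P_n)\in\mathcal{P}^n$; $(P_i',P_{-i})$ denotes the profile obtained from $P$ by replacing $P_i$ with $P_i'$. A (social choice) rule is a function $f:\mathcal{P}^n\to X$; rules are assumed throughout to be unanimous, i.e., $f(P)=x$ whenever $t(P_i)=x$ for each $i\in N$. - $f$ is tops-only if $f(P)=f(P')$ for all $P,P'\in\mathcal{P}^n$ with $t(P_i)=t(P_i')$ for each $i\in N$. - Agent $i$ manipulates $f$ at $P$ via $P_i'\in\mathcal{P}$ if $f(P_i',P_{-i})\,P_i\,f(P)$. - For a tops-only rule $f$, profile $P$ is manipulable for $f$ if there are $i\in N$ and $P_i^\star,P_i'\in\mathcal{P}$ such that $t(P_i^\star)=t(P_i)$ and $i$ manipulates $f$ at $(P_i^\star,P_{-i})$ via $P_i'$. - Profile $P$ is dictatorial for $f$ if, for each $i\in N$ such that $t(P_i)\ne f(P)$, we have $f(P_i',P_{-i})=f(P)$ for each $P_i'\in\mathcal{P}$. *)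

theory Defs
  imports Main "HOL-Library.FuncSet"
begin

(* (x, y) \<in> R reads: x is strictly preferred to y.
   The carrier condition makes R a relation over X only. *)
definition preferences :: "'a set \<Rightarrow> 'a rel set" where
  "preferences X = {R. R \<subseteq> X \<times> X \<and> strict_linear_order_on X R}"

(* Well defined for a preference over a finite nonempty X. *)
definition top_alt :: "'a set \<Rightarrow> 'a rel \<Rightarrow> 'a" where
  "top_alt X R = (THE x. x \<in> X \<and> (\<forall>y\<in>X. y \<noteq> x \<longrightarrow> (x, y) \<in> R))"

(* The agents are 1, ..., n. Profiles are extensional functions on {1..n},
   so that they correspond exactly to n-tuples of preferences. *)
definition profiles :: "nat \<Rightarrow> 'a set \<Rightarrow> (nat \<Rightarrow> 'a rel) set" where
  "profiles n X = {1..n} \<rightarrow>\<^sub>E preferences X"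

definition unanimous :: "nat \<Rightarrow> 'a set \<Rightarrow> ((nat \<Rightarrow> 'a rel) \<Rightarrow> 'a) \<Rightarrow> bool" where
  "unanimous n X f \<longleftrightarrow>
     (\<forall>P\<in>profiles n X. \<forall>x\<in>X. (\<forall>i\<in>{1..n}. top_alt X (P i) = x) \<longrightarrow> f P = x)"

definition social_choice_rule :: "nat \<Rightarrow> 'a set \<Rightarrow> ((nat \<Rightarrow> 'a rel) \<Rightarrow> 'a) \<Rightarrow> bool" where
  "social_choice_rule n X f \<longleftrightarrow> f \<in> profiles n X \<rightarrow> X \<and> unanimous n X f"

definition tops_only :: "nat \<Rightarrow> 'a set \<Rightarrow> ((nat \<Rightarrow> 'a rel) \<Rightarrow> 'a) \<Rightarrow> bool" where
  "tops_only n X f \<longleftrightarrow>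
     (\<forall>P\<in>profiles n X. \<forall>P'\<in>profiles n X.
        (\<forall>i\<in>{1..n}. top_alt X (P i) = top_alt X (P' i)) \<longrightarrow> f P = f P')"

definition manipulates ::
  "((nat \<Rightarrow> 'a rel) \<Rightarrow> 'a) \<Rightarrow> nat \<Rightarrow> (nat \<Rightarrow> 'a rel) \<Rightarrow> 'a rel \<Rightarrow> bool" where
  "manipulates f i P R' \<longleftrightarrow> (f (P(i := R')), f P) \<in> P i"

definition manipulable_profile ::
  "nat \<Rightarrow> 'a set \<Rightarrow> ((nat \<Rightarrow> 'a rel) \<Rightarrow> 'a) \<Rightarrow> (nat \<Rightarrow> 'a rel) \<Rightarrow> bool" where
  "manipulable_profile n X f P \<longleftrightarrow>
     (\<exists>i\<in>{1..n}. \<exists>R\<in>preferences X. \<exists>R'\<in>preferences X.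
        top_alt X R = top_alt X (P i) \<and> manipulates f i (P(i := R)) R')"

definition dictatorial_profile ::
  "nat \<Rightarrow> 'a set \<Rightarrow> ((nat \<Rightarrow> 'a rel) \<Rightarrow> 'a) \<Rightarrow> (nat \<Rightarrow> 'a rel) \<Rightarrow> bool" where
  "dictatorial_profile n X f P \<longleftrightarrow>
     (\<forall>i\<in>{1..n}. top_alt X (P i) \<noteq> f P \<longrightarrow>
        (\<forall>R'\<in>preferences X. f (P(i := R')) = f P))"

end

(* Moving an alternative x to the bottom of a preference keeps the top, provided the top is not x.
   If f(P) = x is neither the top of agent i nor the outcome y after some change of report by i,
   then moving x to the bottom of P_i leaves the outcome x (tops-onlyness) but makes y better than x,
   so i manipulates. Conversely, in a dictatorial profile every agent either already gets her top
   or cannot change the outcome. *)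

theory Submission
  imports Defs
begin

text \<open>Two distinct greatest alternatives would each beat the other, which transitivity and
  irreflexivity forbid; so the definite description denotes.\<close>

lemma top_alt_unique:
  assumes "R \<in> preferences X" "x \<in> X" "\<forall>y\<in>X. y \<noteq> x \<longrightarrow> (x, y) \<in> R"
  shows "top_alt X R = x"
  unfolding top_alt_def
proof (rule the_equality)
  fix z assume "z \<in> X \<and> (\<forall>y\<in>X. y \<noteq> z \<longrightarrow> (z, y) \<in> R)"
  moreover have "trans R" "irrefl R"
    using assms(1) by (auto simp: preferences_def strict_linear_order_on_def)
  ultimately show "z = x"
    using assms(2,3) by (metis irreflD transD)
qed (use assms in blast)

text \<open>A finite acyclic relation is well-founded, which provides an alternative that nothing in
  \<open>X\<close> beats.\<close>

lemma top_alt_greatest: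
  assumes "R \<in> preferences X" "finite X" "X \<noteq> {}"
  shows "top_alt X R \<in> X" and "\<And>y. y \<in> X \<Longrightarrow> y \<noteq> top_alt X R \<Longrightarrow> (top_alt X R, y) \<in> R"
proof -
  have R: "R \<subseteq> X \<times> X" "trans R" "irrefl R" "total_on X R"
    using assms(1) by (auto simp: preferences_def strict_linear_order_on_def)
  have "finite R"
    using R(1) assms(2) by (meson finite_SigmaI finite_subset)
  moreover have "acyclic R"
    using R(2,3) by (simp add: acyclic_irrefl)
  ultimately have "wf R"
    by (rule finite_acyclic_wf)
  \<comment> \<open>Pairs list the better alternative first, so minimal in the sense of
    \<open>wf\<close> means best; totality then makes it greatest.\<close>
  then obtain x where x: "x \<in> X" "\<And>y. (y, x) \<in> R \<Longrightarrow> y \<notin> X"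
    using assms(3) by (metis ex_in_conv wfE_min)
  then have greatest: "\<forall>y\<in>X. y \<noteq> x \<longrightarrow> (x, y) \<in> R"
    using R(4) by (metis total_on_def)
  then have "top_alt X R = x"
    using assms(1) x(1) by (simp add: top_alt_unique)
  then show "top_alt X R \<in> X" and "\<And>y. y \<in> X \<Longrightarrow> y \<noteq> top_alt X R \<Longrightarrow> (top_alt X R, y) \<in> R"
    using x(1) greatest by auto
qed

definition move_to_bottom :: "'a set \<Rightarrow> 'a \<Rightarrow> 'a rel \<Rightarrow> 'a rel" where
  "move_to_bottom X x R = {(u, v) \<in> X \<times> X. u \<noteq> x \<and> (v = x \<or> (u, v) \<in> R)}"

lemma move_to_bottom_preferences:
  assumes "R \<in> preferences X"
  shows "move_to_bottom X x R \<in> preferences X"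
proof -
  have R: "trans R" "irrefl R" "total_on X R"
    using assms by (auto simp: preferences_def strict_linear_order_on_def)
  have "trans (move_to_bottom X x R)"
    using R(1) unfolding move_to_bottom_def by (auto intro!: transI dest: transD)
  moreover have "irrefl (move_to_bottom X x R)"
    using R(2) by (auto simp: move_to_bottom_def irrefl_def)
  moreover have "total_on X (move_to_bottom X x R)"
    using R(3) by (auto simp: move_to_bottom_def total_on_def)
  ultimately show ?thesis
    by (auto simp: preferences_def strict_linear_order_on_def move_to_bottom_def)
qed

text \<open>Only pairs headed by \<open>x\<close> are lost, so the old top still beats everything
  else and uniqueness applies.\<close>

lemma top_alt_move_to_bottom:
  assumes "R \<in> preferences X" "finite X" "X \<noteq> {}" "top_alt X R \<noteq> x"
  shows "top_alt X (move_to_bottom X x R) = top_alt X R"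
  using assms top_alt_greatest[OF assms(1-3)]
  by (intro top_alt_unique move_to_bottom_preferences) (auto simp: move_to_bottom_def)

lemma profiles_update:
  assumes "P \<in> profiles n X" "i \<in> {1..n}" "R \<in> preferences X"
  shows "P(i := R) \<in> profiles n X"
  using assms by (auto simp: profiles_def PiE_iff extensional_def)

text \<open>Manipulability lets agent \<open>i\<close> start from any preference with the same top;
  this identifies the outcome there with \<open>f P\<close>.\<close>

lemma tops_only_update:
  assumes "tops_only n X f" "P \<in> profiles n X" "i \<in> {1..n}" "R \<in> preferences X"
    and "top_alt X R = top_alt X (P i)"
  shows "f (P(i := R)) = f P"
proof -
  have "\<forall>j\<in>{1..n}. top_alt X ((P(i := R)) j) = top_alt X (P j)"
    using assms(5) by simp
  then show ?thesis
    using assms(1,2) profiles_update[OF assms(2-4)] unfolding tops_only_def by blast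
qed

lemma manipulable_if_not_dictatorial:
  assumes "finite X" "f \<in> profiles n X \<rightarrow> X" "tops_only n X f" "P \<in> profiles n X"
    and "\<not> dictatorial_profile n X f P"
  shows "manipulable_profile n X f P"
proof -
  obtain i R' where i: "i \<in> {1..n}" "top_alt X (P i) \<noteq> f P"
    and R': "R' \<in> preferences X" "f (P(i := R')) \<noteq> f P"
    using assms(5) unfolding dictatorial_profile_def by blast
  have Pi: "P i \<in> preferences X"
    using assms(4) i(1) by (auto simp: profiles_def)
  have outcomes: "f P \<in> X" "f (P(i := R')) \<in> X"
    using assms(2,4) profiles_update[OF assms(4) i(1) R'(1)] by auto
  define R where "R = move_to_bottom X (f P) (P i)"
  have R: "R \<in> preferences X"
    unfolding R_def using Pi by (rule move_to_bottom_preferences)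
  have top: "top_alt X R = top_alt X (P i)"
    unfolding R_def using Pi assms(1) outcomes(1) i(2) by (intro top_alt_move_to_bottom) auto
  have "f (P(i := R)) = f P"
    using assms(3,4) i(1) R top by (rule tops_only_update)
  \<comment> \<open>The second update at \<open>i\<close> overrides the first, so the deviation
    yields \<open>f (P(i := R'))\<close>; being in \<open>X\<close> and different from
    \<open>f P\<close>, it beats \<open>f P\<close> in \<open>R\<close>.\<close>
  then have "manipulates f i (P(i := R)) R'"
    using outcomes R'(2) by (simp add: manipulates_def R_def move_to_bottom_def)
  then show ?thesis
    unfolding manipulable_profile_def using i(1) R R'(1) top by blast
qed

lemma not_manipulable_if_dictatorial:
  assumes "finite X" "f \<in> profiles n X \<rightarrow> X" "tops_only n X f" "P \<in> profiles n X"
    and "dictatorial_profile n X f P"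
  shows "\<not> manipulable_profile n X f P"
proof
  assume "manipulable_profile n X f P"
  then obtain i R R' where i: "i \<in> {1..n}" and R: "R \<in> preferences X"
    and R': "R' \<in> preferences X" and top: "top_alt X R = top_alt X (P i)"
    and manip: "manipulates f i (P(i := R)) R'"
    unfolding manipulable_profile_def by blast
  have "f (P(i := R)) = f P"
    using assms(3,4) i R top by (rule tops_only_update)
  then have better: "(f (P(i := R')), f P) \<in> R"
    using manip by (simp add: manipulates_def)
  have ord: "R \<subseteq> X \<times> X" "trans R" "irrefl R"
    using R by (auto simp: preferences_def strict_linear_order_on_def)
  \<comment> \<open>A strict improvement is a change of outcome, which a dictatorial profile allows
    only to an agent whose top is already \<open>f P\<close>.\<close>
  then have neq: "f (P(i := R')) \<noteq> f P"
    using better by (metis irreflD)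
  then have "top_alt X (P i) = f P"
    using assms(5) i R' unfolding dictatorial_profile_def by blast
  \<comment> \<open>The pair in \<open>better\<close> lies in \<open>X \<times> X\<close>, so
    \<open>X\<close> is nonempty and contains the new outcome. The top of \<open>R\<close>, which is
    \<open>f P\<close>, thus beats it, closing a 2-cycle.\<close>
  then have "(f P, f (P(i := R'))) \<in> R"
    using top_alt_greatest(2)[OF R assms(1)] ord(1) better neq top by auto
  then show False
    using better ord(2,3) by (meson irreflD transD)
qed

text \<open>"Either ... or" is read exclusively, so the two properties are shown to be
  complementary.\<close>

theorem lemma5:
  fixes n :: nat and X :: "'a set" and f :: "(nat \<Rightarrow> 'a rel) \<Rightarrow> 'a" and P :: "nat \<Rightarrow> 'a rel"
  assumes "n \<ge> 2"
    and "finite X" and "card X \<ge> 3"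
    and "social_choice_rule n X f"
    and "tops_only n X f"
    and "P \<in> profiles n X"
  shows "(dictatorial_profile n X f P \<or> manipulable_profile n X f P) \<and>
    \<not> (dictatorial_profile n X f P \<and> manipulable_profile n X f P)"
proof -
  have "f \<in> profiles n X \<rightarrow> X"
    using assms(4) by (simp add: social_choice_rule_def)
  then show ?thesis
    using assms(2,5,6) manipulable_if_not_dictatorial not_manipulable_if_dictatorial by blast
qed

end
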